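(* Let $\mathcal{C}$ be a finitary extensive category. A presheaf $F\colon\mathcal{C}^{\mathrm{op}}\to\mathsf{Set}$ is a sheaf for the extensive topology on $\mathcal{C}$ if and only if it preserves finite products.
   Context: A category is finitary extensive if it has finite coproducts, it has pullbacks along coprojections of finite coproducts, and for every commutative diagram with top row $Z_1\to Z\leftarrow Z_2$, bottom row the coprojections $X\to X\coprod Y\leftarrow Y$, and vertical maps $Z_1\to X$, $Z\to X\coprod Y$, $Z_2\to Y$, both squares are pullbacks if and only if the top row is a coproduct diagram. The extensive topology on a finitary extensive category is the smallest Grothendieck topology in which, for each finite family $(X_i\to X)_{i\in I}$ exhibiting $X$ as a coproduct of $(X_i)_{i\in I}$, the sieve generated by the family is a covering sieve. A presheaf $F$ preserves finite products if for every finite family $(T_i)_i$ of objects of $\mathcal{C}$ (including the empty family) the natural map $F\bigl(\coprod_i T_i\bigr)\to\prod_i F(T_i)$ is a bijection. *)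

theory Defs
  imports Main "HOL-Library.FuncSet"
begin

section \<open>Categories\<close>

record ('o, 'a) category =
  Obj :: "'o set"
  Arr :: "'a set"
  Dom :: "'a \<Rightarrow> 'o"
  Cod :: "'a \<Rightarrow> 'o"
  Id :: "'o \<Rightarrow> 'a"
  Comp :: "'a \<Rightarrow> 'a \<Rightarrow> 'a"  (infixl \<open>\<cdot>\<index>\<close> 70)

text \<open>Composition is written in the applicative order: \<open>g \<cdot>\<^bsub>C\<^esub> f\<close> is \<open>g\<close> after \<open>f\<close>.\<close>

definition hom :: "('o, 'a) category \<Rightarrow> 'o \<Rightarrow> 'o \<Rightarrow> 'a set" where
  "hom C X Y = {f \<in> Arr C. Dom C f = X \<and> Cod C f = Y}"

locale category =
  fixes C :: "('o, 'a) category" (structure)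
  assumes Dom_Obj: "f \<in> Arr C \<Longrightarrow> Dom C f \<in> Obj C"
    and Cod_Obj: "f \<in> Arr C \<Longrightarrow> Cod C f \<in> Obj C"
    and Id_hom: "X \<in> Obj C \<Longrightarrow> Id C X \<in> hom C X X"
    and Comp_hom: "\<lbrakk>f \<in> hom C X Y; g \<in> hom C Y Z\<rbrakk> \<Longrightarrow> g \<cdot> f \<in> hom C X Z"
    and Comp_Id: "f \<in> hom C X Y \<Longrightarrow> f \<cdot> Id C X = f"
    and Id_Comp: "f \<in> hom C X Y \<Longrightarrow> Id C Y \<cdot> f = f"
    and Comp_assoc: "\<lbrakk>f \<in> hom C W X; g \<in> hom C X Y; h \<in> hom C Y Z\<rbrakk>
      \<Longrightarrow> (h \<cdot> g) \<cdot> f = h \<cdot> (g \<cdot> f)"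

section \<open>Coproducts, pullbacks and finitary extensive categories\<close>

definition is_coproduct ::
    "('o, 'a) category \<Rightarrow> 'i set \<Rightarrow> ('i \<Rightarrow> 'o) \<Rightarrow> 'o \<Rightarrow> ('i \<Rightarrow> 'a) \<Rightarrow> bool" where
  "is_coproduct C I T X \<iota> \<longleftrightarrow>
     X \<in> Obj C \<and> (\<forall>i\<in>I. T i \<in> Obj C \<and> \<iota> i \<in> hom C (T i) X) \<and>
     (\<forall>Y\<in>Obj C. \<forall>f. (\<forall>i\<in>I. f i \<in> hom C (T i) Y) \<longrightarrow>
        (\<exists>!h. h \<in> hom C X Y \<and> (\<forall>i\<in>I. h \<cdot>\<^bsub>C\<^esub> \<iota> i = f i)))"

definition is_binary_coproduct ::
    "('o, 'a) category \<Rightarrow> 'o \<Rightarrow> 'o \<Rightarrow> 'o \<Rightarrow> 'a \<Rightarrow> 'a \<Rightarrow> bool" where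
  "is_binary_coproduct C X Y P \<iota>\<^sub>1 \<iota>\<^sub>2 \<longleftrightarrow>
     is_coproduct C (UNIV :: bool set) (case_bool X Y) P (case_bool \<iota>\<^sub>1 \<iota>\<^sub>2)"

text \<open>The square with legs \<open>p : W \<rightarrow> A\<close>, \<open>q : W \<rightarrow> B\<close> over the cospan
  \<open>f : A \<rightarrow> X\<close>, \<open>g : B \<rightarrow> X\<close>.\<close>

definition is_pullback :: "('o, 'a) category \<Rightarrow> 'a \<Rightarrow> 'a \<Rightarrow> 'a \<Rightarrow> 'a \<Rightarrow> bool" where
  "is_pullback C p q f g \<longleftrightarrow>
     (\<exists>W A B X. p \<in> hom C W A \<and> q \<in> hom C W B \<and> f \<in> hom C A X \<and> g \<in> hom C B X \<and>
        f \<cdot>\<^bsub>C\<^esub> p = g \<cdot>\<^bsub>C\<^esub> q \<and>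
        (\<forall>V\<in>Obj C. \<forall>u\<in>hom C V A. \<forall>v\<in>hom C V B. f \<cdot>\<^bsub>C\<^esub> u = g \<cdot>\<^bsub>C\<^esub> v \<longrightarrow>
           (\<exists>!h. h \<in> hom C V W \<and> p \<cdot>\<^bsub>C\<^esub> h = u \<and> q \<cdot>\<^bsub>C\<^esub> h = v)))"

text \<open>HOL formulas cannot quantify over types, so finite families are indexed by finite sets
  of natural numbers (possibly empty); every finite family is of this form up to reindexing.
  Coproducts are not chosen: conditions on \<open>\<Coprod>\<^sub>i T\<^sub>i\<close> are imposed on every coproduct
  cocone.\<close>

locale finitary_extensive = category +
  assumes has_finite_coproducts:
    "\<And>(I :: nat set) T. \<lbrakk>finite I; \<forall>i\<in>I. T i \<in> Obj C\<rbrakk> \<Longrightarrow> \<exists>X \<iota>. is_coproduct C I T X \<iota>"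
  and has_pullbacks_along_coprojections:
    "\<And>(I :: nat set) T X \<iota> i Z f. \<lbrakk>finite I; is_coproduct C I T X \<iota>; i \<in> I; f \<in> hom C Z X\<rbrakk>
      \<Longrightarrow> \<exists>p q. is_pullback C p q (\<iota> i) f"
  and extensive:
    "\<And>X Y P \<iota>\<^sub>1 \<iota>\<^sub>2 Z\<^sub>1 Z Z\<^sub>2 z\<^sub>1 z\<^sub>2 a h b.
      \<lbrakk>is_binary_coproduct C X Y P \<iota>\<^sub>1 \<iota>\<^sub>2;
       z\<^sub>1 \<in> hom C Z\<^sub>1 Z; z\<^sub>2 \<in> hom C Z\<^sub>2 Z;
       a \<in> hom C Z\<^sub>1 X; h \<in> hom C Z P; b \<in> hom C Z\<^sub>2 Y;
       \<iota>\<^sub>1 \<cdot> a = h \<cdot> z\<^sub>1; \<iota>\<^sub>2 \<cdot> b = h \<cdot> z\<^sub>2\<rbrakk>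
      \<Longrightarrow> (is_pullback C a z\<^sub>1 \<iota>\<^sub>1 h \<and> is_pullback C b z\<^sub>2 \<iota>\<^sub>2 h) \<longleftrightarrow>
          is_binary_coproduct C Z\<^sub>1 Z\<^sub>2 Z z\<^sub>1 z\<^sub>2"

section \<open>Grothendieck topologies\<close>

definition is_sieve :: "('o, 'a) category \<Rightarrow> 'o \<Rightarrow> 'a set \<Rightarrow> bool" where
  "is_sieve C X S \<longleftrightarrow>
     X \<in> Obj C \<and> S \<subseteq> {f \<in> Arr C. Cod C f = X} \<and>
     (\<forall>f\<in>S. \<forall>g\<in>Arr C. Cod C g = Dom C f \<longrightarrow> f \<cdot>\<^bsub>C\<^esub> g \<in> S)"

definition maximal_sieve :: "('o, 'a) category \<Rightarrow> 'o \<Rightarrow> 'a set" where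
  "maximal_sieve C X = {f \<in> Arr C. Cod C f = X}"

definition pullback_sieve :: "('o, 'a) category \<Rightarrow> 'a \<Rightarrow> 'a set \<Rightarrow> 'a set" where
  "pullback_sieve C f S = {g \<in> Arr C. Cod C g = Dom C f \<and> f \<cdot>\<^bsub>C\<^esub> g \<in> S}"

definition generated_sieve :: "('o, 'a) category \<Rightarrow> 'a set \<Rightarrow> 'a set" where
  "generated_sieve C A = {f \<cdot>\<^bsub>C\<^esub> g | f g. f \<in> A \<and> g \<in> Arr C \<and> Cod C g = Dom C f}"

definition grothendieck_topology :: "('o, 'a) category \<Rightarrow> ('o \<Rightarrow> 'a set set) \<Rightarrow> bool" where
  "grothendieck_topology C J \<longleftrightarrow>
     (\<forall>X. \<forall>S\<in>J X. is_sieve C X S) \<and>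
     (\<forall>X\<in>Obj C. maximal_sieve C X \<in> J X) \<and>
     (\<forall>X Y. \<forall>S\<in>J X. \<forall>f\<in>hom C Y X. pullback_sieve C f S \<in> J Y) \<and>
     (\<forall>X R. \<forall>S\<in>J X. is_sieve C X R \<and> (\<forall>f\<in>S. pullback_sieve C f R \<in> J (Dom C f))
        \<longrightarrow> R \<in> J X)"

definition covers_finite_coproducts :: "('o, 'a) category \<Rightarrow> ('o \<Rightarrow> 'a set set) \<Rightarrow> bool" where
  "covers_finite_coproducts C J \<longleftrightarrow>
     (\<forall>(I :: nat set) T X \<iota>. finite I \<and> is_coproduct C I T X \<iota> \<longrightarrow>
        generated_sieve C (\<iota> ` I) \<in> J X)"

definition extensive_topology :: "('o, 'a) category \<Rightarrow> 'o \<Rightarrow> 'a set set" where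
  "extensive_topology C X =
     \<Inter> {J X | J. grothendieck_topology C J \<and> covers_finite_coproducts C J}"

section \<open>Presheaves and sheaves\<close>

record ('o, 'a, 'x) presheaf =
  Sections :: "'o \<Rightarrow> 'x set"
  Restrict :: "'a \<Rightarrow> 'x \<Rightarrow> 'x"

text \<open>For \<open>f : X \<rightarrow> Y\<close>, only the values of \<open>Restrict F f\<close> on \<open>Sections F Y\<close> are meaningful.\<close>

locale presheaf = category C for C :: "('o, 'a) category" (structure) +
  fixes F :: "('o, 'a, 'x) presheaf"
  assumes Restrict_maps: "f \<in> hom C X Y \<Longrightarrow> Restrict F f \<in> Sections F Y \<rightarrow> Sections F X"
    and Restrict_Id: "\<lbrakk>X \<in> Obj C; x \<in> Sections F X\<rbrakk> \<Longrightarrow> Restrict F (Id C X) x = x"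
    and Restrict_Comp: "\<lbrakk>f \<in> hom C X Y; g \<in> hom C Y Z; x \<in> Sections F Z\<rbrakk>
      \<Longrightarrow> Restrict F (g \<cdot> f) x = Restrict F f (Restrict F g x)"

definition matching_family ::
    "('o, 'a) category \<Rightarrow> ('o, 'a, 'x) presheaf \<Rightarrow> 'a set \<Rightarrow> ('a \<Rightarrow> 'x) \<Rightarrow> bool" where
  "matching_family C F S s \<longleftrightarrow>
     (\<forall>f\<in>S. s f \<in> Sections F (Dom C f)) \<and>
     (\<forall>f\<in>S. \<forall>g\<in>Arr C. Cod C g = Dom C f \<longrightarrow> s (f \<cdot>\<^bsub>C\<^esub> g) = Restrict F g (s f))"

definition is_sheaf ::
    "('o, 'a) category \<Rightarrow> ('o \<Rightarrow> 'a set set) \<Rightarrow> ('o, 'a, 'x) presheaf \<Rightarrow> bool" where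
  "is_sheaf C J F \<longleftrightarrow>
     (\<forall>X\<in>Obj C. \<forall>S\<in>J X. \<forall>s. matching_family C F S s \<longrightarrow>
        (\<exists>!x. x \<in> Sections F X \<and> (\<forall>f\<in>S. Restrict F f x = s f)))"

definition preserves_finite_products ::
    "('o, 'a) category \<Rightarrow> ('o, 'a, 'x) presheaf \<Rightarrow> bool" where
  "preserves_finite_products C F \<longleftrightarrow>
     (\<forall>(I :: nat set) T X \<iota>. finite I \<and> is_coproduct C I T X \<iota> \<longrightarrow>
        bij_betw (\<lambda>x. \<lambda>i\<in>I. Restrict F (\<iota> i) x) (Sections F X) (\<Pi>\<^sub>E i\<in>I. Sections F (T i)))"

section \<open>The extensive topology is the smallest one\<close>

context category
begin

lemma generated_sieve_is_sieve:
  assumes X: "X \<in> Obj C" and A: "\<And>f. f \<in> A \<Longrightarrow> f \<in> Arr C \<and> Cod C f = X"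
  shows "is_sieve C X (generated_sieve C A)"
proof -
  have "f \<cdot> g \<in> Arr C \<and> Cod C (f \<cdot> g) = X \<and> Dom C (f \<cdot> g) = Dom C g"
    if "f \<in> A" "g \<in> Arr C" "Cod C g = Dom C f" for f g
    using Comp_hom[of g "Dom C g" "Dom C f" f X] A[OF that(1)] that by (auto simp: hom_def)
  moreover have "(f \<cdot> g) \<cdot> k = f \<cdot> (g \<cdot> k) \<and> g \<cdot> k \<in> Arr C \<and> Cod C (g \<cdot> k) = Dom C f"
    if "f \<in> A" "g \<in> Arr C" "Cod C g = Dom C f" "k \<in> Arr C" "Cod C k = Dom C g" for f g k
    using Comp_assoc[of k "Dom C k" "Dom C g" g "Dom C f" f X]
      Comp_hom[of k "Dom C k" "Dom C g" g "Dom C f"] A[OF that(1)] that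
    by (auto simp: hom_def)
  ultimately show ?thesis
    unfolding is_sieve_def generated_sieve_def using X by fastforce
qed

lemma sieves_topology:
  "grothendieck_topology C (\<lambda>X. {S. is_sieve C X S})"
  "covers_finite_coproducts C (\<lambda>X. {S. is_sieve C X S})"
proof -
  have max: "is_sieve C X (maximal_sieve C X)" if "X \<in> Obj C" for X
    using that Comp_hom by (fastforce simp: is_sieve_def maximal_sieve_def hom_def)
  have pb: "is_sieve C Y (pullback_sieve C f S)" if S: "is_sieve C X S" and f: "f \<in> hom C Y X" for X Y f S
    unfolding is_sieve_def
  proof (intro conjI ballI impI)
    show "Y \<in> Obj C" using f Dom_Obj by (auto simp: hom_def)
    show "pullback_sieve C f S \<subseteq> {g \<in> Arr C. Cod C g = Y}"
      using f by (auto simp: pullback_sieve_def hom_def)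
    fix g k assume g: "g \<in> pullback_sieve C f S" and k: "k \<in> Arr C" "Cod C k = Dom C g"
    have hs: "g \<in> hom C (Dom C g) Y" "k \<in> hom C (Dom C k) (Dom C g)"
      using f g k by (auto simp: pullback_sieve_def hom_def)
    have "f \<cdot> g \<in> S" using g by (simp add: pullback_sieve_def)
    moreover have "Dom C (f \<cdot> g) = Dom C g" using Comp_hom[OF hs(1) f] by (simp add: hom_def)
    ultimately have "(f \<cdot> g) \<cdot> k \<in> S" using S k by (simp add: is_sieve_def)
    then show "g \<cdot> k \<in> pullback_sieve C f S"
      using Comp_assoc[OF hs(2,1) f] Comp_hom[OF hs(2,1)] f
      by (auto simp: pullback_sieve_def hom_def)
  qed
  show "grothendieck_topology C (\<lambda>X. {S. is_sieve C X S})"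
    using max pb unfolding grothendieck_topology_def by blast
  show "covers_finite_coproducts C (\<lambda>X. {S. is_sieve C X S})"
    unfolding covers_finite_coproducts_def
    by (auto intro!: generated_sieve_is_sieve simp: is_coproduct_def hom_def)
qed

lemma extensive_topology_topology: "grothendieck_topology C (extensive_topology C)"
proof -
  define \<J> where "\<J> = {J. grothendieck_topology C J \<and> covers_finite_coproducts C J}"
  have ext: "S \<in> extensive_topology C X \<longleftrightarrow> (\<forall>J\<in>\<J>. S \<in> J X)" for S X
    by (auto simp: extensive_topology_def \<J>_def)
  have stable: "pullback_sieve C f S \<in> J Y" if "J \<in> \<J>" "S \<in> J X" "f \<in> hom C Y X" for J X Y f S
    using that unfolding \<J>_def grothendieck_topology_def mem_Collect_eq by metis
  have local_char: "R \<in> J X"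
    if "J \<in> \<J>" "S \<in> J X" "is_sieve C X R" "\<forall>f\<in>S. pullback_sieve C f R \<in> J (Dom C f)" for J X R S
    using that unfolding \<J>_def grothendieck_topology_def mem_Collect_eq by metis
  have maximal: "maximal_sieve C X \<in> J X" if "J \<in> \<J>" "X \<in> Obj C" for J X
    using that unfolding \<J>_def grothendieck_topology_def mem_Collect_eq by metis
  have all: "(\<lambda>X. {S. is_sieve C X S}) \<in> \<J>"
    unfolding \<J>_def using sieves_topology by blast
  show ?thesis
    unfolding grothendieck_topology_def
  proof (intro conjI allI ballI impI)
    fix X S assume "S \<in> extensive_topology C X"
    then have "\<forall>J\<in>\<J>. S \<in> J X" by (simp only: ext)
    from bspec[OF this all] show "is_sieve C X S" by simp
  next
    fix X assume "X \<in> Obj C"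
    then show "maximal_sieve C X \<in> extensive_topology C X"
      unfolding ext by (intro ballI maximal)
  next
    fix X Y S f assume S: "S \<in> extensive_topology C X" and f: "f \<in> hom C Y X"
    show "pullback_sieve C f S \<in> extensive_topology C Y"
      unfolding ext
    proof
      fix J assume J: "J \<in> \<J>"
      have "S \<in> J X" using S J by (simp only: ext)
      from stable[OF J this f] show "pullback_sieve C f S \<in> J Y" .
    qed
  next
    fix X R S assume S: "S \<in> extensive_topology C X"
      and R: "is_sieve C X R \<and> (\<forall>f\<in>S. pullback_sieve C f R \<in> extensive_topology C (Dom C f))"
    show "R \<in> extensive_topology C X"
      unfolding ext
    proof
      fix J assume J: "J \<in> \<J>"
      have "S \<in> J X" "\<forall>f\<in>S. pullback_sieve C f R \<in> J (Dom C f)"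
        using S R J unfolding ext by blast+
      with R show "R \<in> J X" by (intro local_char[OF J, of S X R]) auto
    qed
  qed
qed

end

lemma extensive_topology_covers: "covers_finite_coproducts C (extensive_topology C)"
  by (auto simp: covers_finite_coproducts_def extensive_topology_def)

lemma extensive_topology_least:
  "\<lbrakk>grothendieck_topology C J; covers_finite_coproducts C J\<rbrakk> \<Longrightarrow> extensive_topology C X \<subseteq> J X"
  by (auto simp: extensive_topology_def)

end

theory Submission
  imports Defs
begin

text \<open>Why the theorem holds. A matching family on the sieve generated by a finite coproduct
  \<open>\<iota>\<^sub>i : T\<^sub>i \<rightarrow> X\<close> is determined by its values on the coprojections, that is, by a tuple
  \<open>(t\<^sub>i)\<close> in \<open>\<Prod>\<^sub>i F(T\<^sub>i)\<close>; a tuple comes from a matching family as soon as \<open>t\<^sub>i\<close> and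
  \<open>t\<^sub>j\<close> agree wherever \<open>\<iota>\<^sub>i u = \<iota>\<^sub>j v\<close>. Bijectivity of \<open>F(X) \<rightarrow> \<Prod>\<^sub>i F(T\<^sub>i)\<close> therefore means
  unique gluing along this one sieve, provided that this compatibility is automatic. Extensivity
  enters in two ways.

  From sheaves to products, it makes the compatibility automatic. Coprojections are monic
  (\<open>coprojection_mono\<close>), which settles \<open>i = j\<close>. For \<open>i \<noteq> j\<close> they are disjoint
  (\<open>coprojections_disjoint\<close>): \<open>u\<close> and \<open>v\<close> factor through the initial object. As the empty
  sieve covers the initial object, a sheaf has at most one section there, so
  the two restrictions agree.

  From products to sheaves, the difficulty is that the extensive topology is generated by the
  coproduct sieves and contains many others, so gluing along the generators is not enough.
  The sieves along all of whose pullbacks \<open>F\<close> has unique gluing do form a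
  Grothendieck topology (\<open>sheaf_topology_topology\<close>); by minimality it remains to see that it
  contains the coproduct sieves. By transitivity only the empty and the binary coproducts
  matter (\<open>covers_finite_coproductsI\<close>), and for these extensivity shows that a pullback of a
  coproduct sieve is again a coproduct sieve (\<open>initial_strict\<close>, \<open>binary_coproduct_universal\<close>),
  along which \<open>F\<close> glues because it preserves products.\<close>

section \<open>Coproducts in a category\<close>

definition is_initial :: "('o, 'a) category \<Rightarrow> 'o \<Rightarrow> bool" where
  "is_initial C Z \<longleftrightarrow> Z \<in> Obj C \<and> (\<forall>Y\<in>Obj C. \<exists>!h. h \<in> hom C Z Y)"

lemma is_coproduct_empty_iff: "is_coproduct C {} T Z \<iota> \<longleftrightarrow> is_initial C Z"
  by (simp add: is_coproduct_def is_initial_def)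

lemma is_binary_coproduct_iff:
  "is_binary_coproduct C X Y P \<iota>\<^sub>1 \<iota>\<^sub>2 \<longleftrightarrow>
     X \<in> Obj C \<and> Y \<in> Obj C \<and> P \<in> Obj C \<and> \<iota>\<^sub>1 \<in> hom C X P \<and> \<iota>\<^sub>2 \<in> hom C Y P \<and>
     (\<forall>W\<in>Obj C. \<forall>f\<in>hom C X W. \<forall>g\<in>hom C Y W.
        \<exists>!h. h \<in> hom C P W \<and> h \<cdot>\<^bsub>C\<^esub> \<iota>\<^sub>1 = f \<and> h \<cdot>\<^bsub>C\<^esub> \<iota>\<^sub>2 = g)" (is "?L \<longleftrightarrow> ?R")
proof
  assume L: ?L
  have "\<exists>!h. h \<in> hom C P W \<and> h \<cdot>\<^bsub>C\<^esub> \<iota>\<^sub>1 = f \<and> h \<cdot>\<^bsub>C\<^esub> \<iota>\<^sub>2 = g"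
    if W: "W \<in> Obj C" and f: "f \<in> hom C X W" and g: "g \<in> hom C Y W" for W f g
  proof -
    have "\<forall>f. (\<forall>i\<in>(UNIV :: bool set). f i \<in> hom C (case_bool X Y i) W) \<longrightarrow>
        (\<exists>!h. h \<in> hom C P W \<and> (\<forall>i\<in>UNIV. h \<cdot>\<^bsub>C\<^esub> case_bool \<iota>\<^sub>1 \<iota>\<^sub>2 i = f i))"
      using L W unfolding is_binary_coproduct_def is_coproduct_def by blast
    from spec[OF this, of "case_bool f g"] show ?thesis
      using f g by (simp add: all_bool_eq)
  qed
  then show ?R
    using L unfolding is_binary_coproduct_def is_coproduct_def by (simp add: all_bool_eq)
next
  assume ?R
  then show ?L
    unfolding is_binary_coproduct_def is_coproduct_def by (simp add: all_bool_eq)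
qed

text \<open>Finite families indexed by natural numbers and the binary ones indexed by \<open>bool\<close> are
  different instances of the same notion; reindexing transports results between them.\<close>
lemma is_coproduct_reindex:
  assumes cop: "is_coproduct C I T X \<iota>" and \<phi>: "bij_betw \<phi> K I"
  shows "is_coproduct C K (T \<circ> \<phi>) X (\<iota> \<circ> \<phi>)"
  unfolding is_coproduct_def
proof (intro conjI ballI allI impI)
  show "X \<in> Obj C" using cop by (simp add: is_coproduct_def)
  fix k assume "k \<in> K"
  then have "\<phi> k \<in> I" using \<phi> by (auto simp: bij_betw_def)
  then show "(T \<circ> \<phi>) k \<in> Obj C" "(\<iota> \<circ> \<phi>) k \<in> hom C ((T \<circ> \<phi>) k) X"
    using cop by (simp_all add: is_coproduct_def)
next
  fix Y f assume Y: "Y \<in> Obj C" and f: "\<forall>k\<in>K. f k \<in> hom C ((T \<circ> \<phi>) k) Y"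
  let ?\<psi> = "inv_into K \<phi>"
  have img: "\<phi> ` K = I" and inj: "inj_on \<phi> K" using \<phi> by (auto simp: bij_betw_def)
  have "\<forall>i\<in>I. f (?\<psi> i) \<in> hom C (T i) Y"
    using f img by (auto simp: inv_into_f_f[OF inj])
  moreover have "(\<forall>i\<in>I. h \<cdot>\<^bsub>C\<^esub> \<iota> i = f (?\<psi> i)) \<longleftrightarrow> (\<forall>k\<in>K. h \<cdot>\<^bsub>C\<^esub> (\<iota> \<circ> \<phi>) k = f k)" for h
    unfolding img[symmetric] by (simp add: inv_into_f_f[OF inj])
  moreover have "\<exists>!h. h \<in> hom C X Y \<and> (\<forall>i\<in>I. h \<cdot>\<^bsub>C\<^esub> \<iota> i = f (?\<psi> i))"
  proof -
    have "\<forall>f. (\<forall>i\<in>I. f i \<in> hom C (T i) Y) \<longrightarrow>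
        (\<exists>!h. h \<in> hom C X Y \<and> (\<forall>i\<in>I. h \<cdot>\<^bsub>C\<^esub> \<iota> i = f i))"
      using cop Y unfolding is_coproduct_def by blast
    from spec[OF this, of "\<lambda>i. f (?\<psi> i)"] show ?thesis using calculation(1) by blast
  qed
  ultimately show "\<exists>!h. h \<in> hom C X Y \<and> (\<forall>k\<in>K. h \<cdot>\<^bsub>C\<^esub> (\<iota> \<circ> \<phi>) k = f k)" by simp
qed

lemma binary_coproduct_nat_indexed:
  assumes "is_binary_coproduct C X Y P \<iota>\<^sub>1 \<iota>\<^sub>2"
  shows "is_coproduct C {0, 1 :: nat} (case_bool X Y \<circ> (\<lambda>n. n = 0)) P
           (case_bool \<iota>\<^sub>1 \<iota>\<^sub>2 \<circ> (\<lambda>n. n = 0))"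
proof (rule is_coproduct_reindex)
  show "is_coproduct C UNIV (case_bool X Y) P (case_bool \<iota>\<^sub>1 \<iota>\<^sub>2)"
    using assms by (simp add: is_binary_coproduct_def)
  show "bij_betw (\<lambda>n::nat. n = 0) {0, 1} UNIV"
    by (auto simp: bij_betw_def UNIV_bool)
qed

text \<open>The objects hidden in the definition of a pullback are the domains and codomains of its
  arrows, so they can be prescribed.\<close>
lemma is_pullback_iff:
  assumes "p \<in> hom C W A" "q \<in> hom C W B" "f \<in> hom C A X" "g \<in> hom C B X"
  shows "is_pullback C p q f g \<longleftrightarrow> f \<cdot>\<^bsub>C\<^esub> p = g \<cdot>\<^bsub>C\<^esub> q \<and>
    (\<forall>V\<in>Obj C. \<forall>u\<in>hom C V A. \<forall>v\<in>hom C V B. f \<cdot>\<^bsub>C\<^esub> u = g \<cdot>\<^bsub>C\<^esub> v \<longrightarrow>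
       (\<exists>!h. h \<in> hom C V W \<and> p \<cdot>\<^bsub>C\<^esub> h = u \<and> q \<cdot>\<^bsub>C\<^esub> h = v))"
proof -
  have "W' = W \<and> A' = A \<and> B' = B"
    if "p \<in> hom C W' A'" "q \<in> hom C W' B'" for W' A' B'
    using that assms unfolding hom_def by blast
  then show ?thesis using assms unfolding is_pullback_def by blast
qed

context category
begin

lemma hom_Obj: "f \<in> hom C X Y \<Longrightarrow> X \<in> Obj C \<and> Y \<in> Obj C"
  using Dom_Obj Cod_Obj by (auto simp: hom_def)

lemma pullback_lift:
  assumes "is_pullback C p q f g" "p \<in> hom C W A" "q \<in> hom C W B" "f \<in> hom C A X" "g \<in> hom C B X"
    and "u \<in> hom C V A" "v \<in> hom C V B" "f \<cdot> u = g \<cdot> v"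
  obtains h where "h \<in> hom C V W" "p \<cdot> h = u" "q \<cdot> h = v"
proof -
  have "\<exists>!h. h \<in> hom C V W \<and> p \<cdot> h = u \<and> q \<cdot> h = v"
    using assms(1,6-8) hom_Obj[OF assms(6)] unfolding is_pullback_iff[OF assms(2-5)] by blast
  then show ?thesis using that by blast
qed

lemma coproduct_universal:
  assumes "is_coproduct C I T X \<iota>" "Y \<in> Obj C" "\<And>i. i \<in> I \<Longrightarrow> f i \<in> hom C (T i) Y"
  shows "\<exists>!h. h \<in> hom C X Y \<and> (\<forall>i\<in>I. h \<cdot> \<iota> i = f i)"
proof -
  have "\<forall>f. (\<forall>i\<in>I. f i \<in> hom C (T i) Y) \<longrightarrow>
      (\<exists>!h. h \<in> hom C X Y \<and> (\<forall>i\<in>I. h \<cdot> \<iota> i = f i))"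
    using assms(1,2) unfolding is_coproduct_def by blast
  from spec[OF this, of f] show ?thesis using assms(3) by blast
qed

lemma coproduct_arrow_eqI:
  assumes "is_coproduct C I T X \<iota>" "h \<in> hom C X Y" "k \<in> hom C X Y"
    and "\<And>i. i \<in> I \<Longrightarrow> h \<cdot> \<iota> i = k \<cdot> \<iota> i"
  shows "h = k"
proof -
  have "Y \<in> Obj C" using assms(2) hom_Obj by blast
  moreover have "k \<cdot> \<iota> i \<in> hom C (T i) Y" if "i \<in> I" for i
    using assms(1,3) Comp_hom that by (auto simp: is_coproduct_def)
  ultimately have "\<exists>!g. g \<in> hom C X Y \<and> (\<forall>i\<in>I. g \<cdot> \<iota> i = k \<cdot> \<iota> i)"
    by (rule coproduct_universal[OF assms(1)])
  then obtain m where m: "\<And>g. g \<in> hom C X Y \<and> (\<forall>i\<in>I. g \<cdot> \<iota> i = k \<cdot> \<iota> i) \<Longrightarrow> g = m"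
    by blast
  have "h = m" by (rule m) (use assms in simp)
  moreover have "k = m" by (rule m) (use assms in simp)
  ultimately show ?thesis by simp
qed

lemma coproduct_copairing:
  assumes "is_coproduct C I T X \<iota>" "Y \<in> Obj C" "\<And>i. i \<in> I \<Longrightarrow> f i \<in> hom C (T i) Y"
  obtains h where "h \<in> hom C X Y" "\<And>i. i \<in> I \<Longrightarrow> h \<cdot> \<iota> i = f i"
  using coproduct_universal[OF assms] that by blast

text \<open>Associativity of coproducts: \<open>\<Coprod>\<^sub>j T\<^sub>j\<close> is \<open>T\<^sub>i + R\<close>, where \<open>R\<close> is the coproduct
  of the remaining summands. This reduces finite coproducts to binary ones, the
  only ones that the extensivity axiom speaks of.\<close>
lemma coproduct_split:
  assumes X: "is_coproduct C (insert i I) T X \<iota>" and i: "i \<notin> I" and R: "is_coproduct C I T R \<kappa>"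
  obtains \<rho> where "\<rho> \<in> hom C R X" "\<forall>j\<in>I. \<rho> \<cdot> \<kappa> j = \<iota> j"
    "is_binary_coproduct C (T i) R X (\<iota> i) \<rho>"
proof -
  have XO: "X \<in> Obj C" and RO: "R \<in> Obj C" and TO: "T i \<in> Obj C"
    and \<iota>: "\<And>j. j \<in> insert i I \<Longrightarrow> \<iota> j \<in> hom C (T j) X"
    and \<kappa>: "\<And>j. j \<in> I \<Longrightarrow> \<kappa> j \<in> hom C (T j) R"
    using X R by (auto simp: is_coproduct_def)
  obtain \<rho> where \<rho>: "\<rho> \<in> hom C R X" and \<rho>\<kappa>: "\<forall>j\<in>I. \<rho> \<cdot> \<kappa> j = \<iota> j"
    using coproduct_copairing[OF R XO, of \<iota>] \<iota> by (metis insertCI)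
  have "\<exists>!h. h \<in> hom C X W \<and> h \<cdot> \<iota> i = f \<and> h \<cdot> \<rho> = g"
    if W: "W \<in> Obj C" and f: "f \<in> hom C (T i) W" and g: "g \<in> hom C R W" for W f g
  proof -
    \<comment> \<open>the family on all of \<open>insert i I\<close> that corresponds to the pair \<open>(f, g)\<close>\<close>
    define c where "c j = (if j = i then f else g \<cdot> \<kappa> j)" for j
    have c: "c j \<in> hom C (T j) W" if "j \<in> insert i I" for j
      using that f Comp_hom[OF \<kappa> g] by (auto simp: c_def)
    obtain h where h: "h \<in> hom C X W" and hc: "\<And>j. j \<in> insert i I \<Longrightarrow> h \<cdot> \<iota> j = c j"
      using coproduct_copairing[OF X W, of c] c by blast
    have assoc: "(k \<cdot> \<rho>) \<cdot> \<kappa> j = k \<cdot> \<iota> j" if "j \<in> I" "k \<in> hom C X W" for j k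
      using Comp_assoc[OF \<kappa> \<rho>] \<rho>\<kappa> that by simp
    have "h \<cdot> \<rho> = g"
    proof (rule coproduct_arrow_eqI[OF R Comp_hom[OF \<rho> h] g])
      fix j assume j: "j \<in> I"
      then show "(h \<cdot> \<rho>) \<cdot> \<kappa> j = g \<cdot> \<kappa> j"
        using assoc[OF j h] hc[of j] i by (auto simp: c_def)
    qed
    moreover have "h \<cdot> \<iota> i = f" using hc[of i] by (simp add: c_def)
    moreover have "k = h" if "k \<in> hom C X W" "k \<cdot> \<iota> i = f" "k \<cdot> \<rho> = g" for k
    proof (rule coproduct_arrow_eqI[OF X that(1) h])
      fix j assume "j \<in> insert i I"
      then show "k \<cdot> \<iota> j = h \<cdot> \<iota> j"
        using assoc[OF _ that(1)] assoc[OF _ h] that \<open>h \<cdot> \<rho> = g\<close> \<open>h \<cdot> \<iota> i = f\<close> by (metis insertE)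
    qed
    ultimately show ?thesis using h by blast
  qed
  then have "is_binary_coproduct C (T i) R X (\<iota> i) \<rho>"
    using XO RO TO \<iota> \<rho> by (simp add: is_binary_coproduct_iff)
  with \<rho> \<rho>\<kappa> that show thesis by blast
qed

lemma binary_coproduct_with_initial:
  assumes X: "X \<in> Obj C" and Z: "is_initial C Z" and e: "e \<in> hom C Z X"
  shows "is_binary_coproduct C X Z X (Id C X) e"
proof -
  have "\<exists>!h. h \<in> hom C X W \<and> h \<cdot> Id C X = f \<and> h \<cdot> e = g"
    if W: "W \<in> Obj C" and f: "f \<in> hom C X W" and g: "g \<in> hom C Z W" for W f g
  proof -
    have "f \<cdot> e = g" using Z W g Comp_hom[OF e f] unfolding is_initial_def by blast
    then show ?thesis using f Comp_Id by metis
  qed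
  then show ?thesis
    using X Z e Id_hom by (simp add: is_binary_coproduct_iff is_initial_def)
qed

end

section \<open>Finitary extensive categories\<close>

context finitary_extensive
begin

lemma obtain_initial:
  obtains Z where "is_initial C Z"
proof -
  have "\<exists>X \<iota>. is_coproduct C ({} :: nat set) T X \<iota>" for T
    by (rule has_finite_coproducts) auto
  then show ?thesis using that is_coproduct_empty_iff by metis
qed

text \<open>Extensivity is applied to the coproduct \<open>X \<rightarrow> X \<leftarrow> 0\<close> lying over
  \<open>X \<rightarrow> X + Y \<leftarrow> Y\<close> via \<open>\<iota>\<^sub>1 : X \<rightarrow> X + Y\<close>. That its left square is a pullback says that \<open>\<iota>\<^sub>1\<close> is
  monic, and the right square says that the summands meet in the initial object.\<close>
lemma binary_coprojection_mono_disjoint: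
  assumes P: "is_binary_coproduct C X Y P \<iota>\<^sub>1 \<iota>\<^sub>2" and Z: "is_initial C Z"
    and e: "e \<in> hom C Z X" and b: "b \<in> hom C Z Y"
  shows "\<And>V u v. \<lbrakk>u \<in> hom C V X; v \<in> hom C V X; \<iota>\<^sub>1 \<cdot> u = \<iota>\<^sub>1 \<cdot> v\<rbrakk> \<Longrightarrow> u = v"
    and "\<And>V u v. \<lbrakk>u \<in> hom C V X; v \<in> hom C V Y; \<iota>\<^sub>1 \<cdot> u = \<iota>\<^sub>2 \<cdot> v\<rbrakk>
           \<Longrightarrow> \<exists>h\<in>hom C V Z. e \<cdot> h = u \<and> b \<cdot> h = v"
proof -
  have X: "X \<in> Obj C" and PO: "P \<in> Obj C" and \<iota>: "\<iota>\<^sub>1 \<in> hom C X P" "\<iota>\<^sub>2 \<in> hom C Y P"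
    using P by (auto simp: is_binary_coproduct_iff)
  have XZ: "is_binary_coproduct C X Z X (Id C X) e"
    by (rule binary_coproduct_with_initial[OF X Z e])
  have be: "\<iota>\<^sub>2 \<cdot> b = \<iota>\<^sub>1 \<cdot> e"
    using Z PO Comp_hom[OF b \<iota>(2)] Comp_hom[OF e \<iota>(1)] unfolding is_initial_def by blast
  have pb1: "is_pullback C (Id C X) (Id C X) \<iota>\<^sub>1 \<iota>\<^sub>1" and pb2: "is_pullback C b e \<iota>\<^sub>2 \<iota>\<^sub>1"
    using extensive[OF P Id_hom[OF X] e Id_hom[OF X] \<iota>(1) b refl be] XZ by auto
  show "u = v" if u: "u \<in> hom C V X" and v: "v \<in> hom C V X" and eq: "\<iota>\<^sub>1 \<cdot> u = \<iota>\<^sub>1 \<cdot> v" for V u v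
  proof -
    obtain h where "h \<in> hom C V X" "Id C X \<cdot> h = u" "Id C X \<cdot> h = v"
      by (rule pullback_lift[OF pb1 Id_hom[OF X] Id_hom[OF X] \<iota>(1) \<iota>(1) u v eq])
    then show ?thesis by simp
  qed
  show "\<exists>h\<in>hom C V Z. e \<cdot> h = u \<and> b \<cdot> h = v"
    if u: "u \<in> hom C V X" and v: "v \<in> hom C V Y" and eq: "\<iota>\<^sub>1 \<cdot> u = \<iota>\<^sub>2 \<cdot> v" for V u v
  proof -
    obtain h where "h \<in> hom C V Z" "b \<cdot> h = v" "e \<cdot> h = u"
      by (rule pullback_lift[OF pb2 b e \<iota>(2) \<iota>(1) v u eq[symmetric]])
    then show ?thesis by blast
  qed
qed

lemma split_off_coprojection:
  fixes I :: "nat set"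
  assumes I: "finite I" "i \<in> I" and X: "is_coproduct C I T X \<iota>"
  obtains R \<kappa> \<rho> where "is_coproduct C (I - {i}) T R \<kappa>" "\<rho> \<in> hom C R X"
    "\<forall>j\<in>I - {i}. \<rho> \<cdot> \<kappa> j = \<iota> j" "is_binary_coproduct C (T i) R X (\<iota> i) \<rho>"
proof -
  have "\<exists>R \<kappa>. is_coproduct C (I - {i}) T R \<kappa>"
    using I X by (intro has_finite_coproducts) (auto simp: is_coproduct_def)
  then obtain R \<kappa> where R: "is_coproduct C (I - {i}) T R \<kappa>" by blast
  have "is_coproduct C (insert i (I - {i})) T X \<iota>" using X I by (simp add: insert_absorb)
  then obtain \<rho> where "\<rho> \<in> hom C R X" "\<forall>j\<in>I - {i}. \<rho> \<cdot> \<kappa> j = \<iota> j"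
    "is_binary_coproduct C (T i) R X (\<iota> i) \<rho>"
    by (rule coproduct_split[OF _ _ R]) simp_all
  then show thesis by (rule that[OF R])
qed

lemma coprojection_mono:
  fixes I :: "nat set"
  assumes I: "finite I" "i \<in> I" and X: "is_coproduct C I T X \<iota>"
    and "u \<in> hom C V (T i)" "v \<in> hom C V (T i)" "\<iota> i \<cdot> u = \<iota> i \<cdot> v"
  shows "u = v"
proof -
  obtain R \<kappa> \<rho> where "is_coproduct C (I - {i}) T R \<kappa>" "\<rho> \<in> hom C R X"
    "\<forall>j\<in>I - {i}. \<rho> \<cdot> \<kappa> j = \<iota> j"
    and P: "is_binary_coproduct C (T i) R X (\<iota> i) \<rho>"
    by (rule split_off_coprojection[OF I X])
  obtain Z where Z: "is_initial C Z" by (rule obtain_initial)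
  obtain e b where "e \<in> hom C Z (T i)" "b \<in> hom C Z R"
    using Z P by (meson is_initial_def is_binary_coproduct_iff)
  from binary_coprojection_mono_disjoint(1)[OF P Z this] show ?thesis using assms by blast
qed

text \<open>Binary disjointness, applied to \<open>T\<^sub>i\<close> and the coproduct \<open>R\<close> of the other summands,
  yields the factorization of \<open>v\<close> only after composition with \<open>T\<^sub>j \<rightarrow> R\<close>, which is monic.\<close>
lemma coprojections_disjoint:
  fixes I :: "nat set"
  assumes I: "finite I" "i \<in> I" "j \<in> I" "i \<noteq> j" and X: "is_coproduct C I T X \<iota>"
    and u: "u \<in> hom C V (T i)" and v: "v \<in> hom C V (T j)" and eq: "\<iota> i \<cdot> u = \<iota> j \<cdot> v"
    and Z: "is_initial C Z" and e: "e \<in> hom C Z (T i)" and d: "d \<in> hom C Z (T j)"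
  obtains h where "h \<in> hom C V Z" "e \<cdot> h = u" "d \<cdot> h = v"
proof -
  obtain R \<kappa> \<rho> where R: "is_coproduct C (I - {i}) T R \<kappa>" and \<rho>: "\<rho> \<in> hom C R X"
    and \<rho>\<kappa>: "\<forall>j\<in>I - {i}. \<rho> \<cdot> \<kappa> j = \<iota> j"
    and P: "is_binary_coproduct C (T i) R X (\<iota> i) \<rho>"
    by (rule split_off_coprojection[OF I(1,2) X])
  have j: "j \<in> I - {i}" using I by blast
  have \<kappa>j: "\<kappa> j \<in> hom C (T j) R" using R j by (simp add: is_coproduct_def)
  have "\<iota> i \<cdot> u = \<rho> \<cdot> (\<kappa> j \<cdot> v)"
    using eq bspec[OF \<rho>\<kappa> j] Comp_assoc[OF v \<kappa>j \<rho>] by simp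
  then obtain h where h: "h \<in> hom C V Z" "e \<cdot> h = u" "(\<kappa> j \<cdot> d) \<cdot> h = \<kappa> j \<cdot> v"
    using binary_coprojection_mono_disjoint(2)[OF P Z e Comp_hom[OF d \<kappa>j] u Comp_hom[OF v \<kappa>j]]
    by blast
  have "\<kappa> j \<cdot> (d \<cdot> h) = \<kappa> j \<cdot> v" using h(3) Comp_assoc[OF h(1) d \<kappa>j] by simp
  then have "d \<cdot> h = v"
    using coprojection_mono[OF _ j R Comp_hom[OF h(1) d] v] I(1) by blast
  with h that show thesis by blast
qed

text \<open>For initial \<open>Z\<close>, the cocone \<open>Z \<rightarrow> Z \<leftarrow> Z\<close> of identities is a coproduct. Pulling it back
  along \<open>f\<close> shows that the identities \<open>Y \<rightarrow> Y \<leftarrow> Y\<close> form a coproduct too, so any two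
  parallel arrows out of \<open>Y\<close> are equal; some arrow exists because \<open>f\<close> leads to \<open>Z\<close>.\<close>
lemma initial_strict:
  assumes Z: "is_initial C Z" and f: "f \<in> hom C Y Z"
  shows "is_initial C Y"
proof -
  have ZO: "Z \<in> Obj C" and YO: "Y \<in> Obj C" using hom_Obj[OF f] by auto
  note idZ = Id_hom[OF ZO] and idY = Id_hom[OF YO]
  have ZZ: "is_binary_coproduct C Z Z Z (Id C Z) (Id C Z)"
    by (rule binary_coproduct_with_initial[OF ZO Z idZ])
  have "is_pullback C f (Id C Y) (Id C Z) f"
    unfolding is_pullback_iff[OF f idY idZ f]
  proof (intro conjI ballI impI)
    show "Id C Z \<cdot> f = f \<cdot> Id C Y" using Comp_Id[OF f] Id_Comp[OF f] by simp
    fix V u v assume u: "u \<in> hom C V Z" and v: "v \<in> hom C V Y" and "Id C Z \<cdot> u = f \<cdot> v"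
    then have "f \<cdot> v = u" using Id_Comp[OF u] by simp
    then show "\<exists>!h. h \<in> hom C V Y \<and> f \<cdot> h = u \<and> Id C Y \<cdot> h = v" using v Id_Comp by metis
  qed
  then have YY: "is_binary_coproduct C Y Y Y (Id C Y) (Id C Y)"
    using extensive[OF ZZ idY idY f f f] Comp_Id[OF f] Id_Comp[OF f] by simp
  have "u = v" if u: "u \<in> hom C Y W" and v: "v \<in> hom C Y W" for u v W
  proof -
    obtain h where "h \<in> hom C Y W" "h \<cdot> Id C Y = u" "h \<cdot> Id C Y = v"
      using YY u v hom_Obj[OF u] unfolding is_binary_coproduct_iff by metis
    then show ?thesis by simp
  qed
  moreover have "\<exists>h. h \<in> hom C Y W" if W: "W \<in> Obj C" for W
    using Z W Comp_hom[OF f] unfolding is_initial_def by blast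
  ultimately show ?thesis using YO unfolding is_initial_def by blast
qed

lemma binary_coproduct_universal:
  assumes P: "is_binary_coproduct C X Y P \<iota>\<^sub>1 \<iota>\<^sub>2" and f: "f \<in> hom C Z P"
  obtains Z\<^sub>1 Z\<^sub>2 a z\<^sub>1 b z\<^sub>2 where "is_pullback C a z\<^sub>1 \<iota>\<^sub>1 f" "is_pullback C b z\<^sub>2 \<iota>\<^sub>2 f"
    "is_binary_coproduct C Z\<^sub>1 Z\<^sub>2 Z z\<^sub>1 z\<^sub>2"
proof -
  have \<iota>: "\<iota>\<^sub>1 \<in> hom C X P" "\<iota>\<^sub>2 \<in> hom C Y P" using P by (auto simp: is_binary_coproduct_iff)
  note N = binary_coproduct_nat_indexed[OF P]
  obtain a z\<^sub>1 where pb1: "is_pullback C a z\<^sub>1 \<iota>\<^sub>1 f"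
    using has_pullbacks_along_coprojections[OF _ N, of 0 f Z] f by auto
  obtain b z\<^sub>2 where pb2: "is_pullback C b z\<^sub>2 \<iota>\<^sub>2 f"
    using has_pullbacks_along_coprojections[OF _ N, of 1 f Z] f by auto
  have 1: "a \<in> hom C (Dom C a) X" "z\<^sub>1 \<in> hom C (Dom C a) Z" "\<iota>\<^sub>1 \<cdot> a = f \<cdot> z\<^sub>1"
    and 2: "b \<in> hom C (Dom C b) Y" "z\<^sub>2 \<in> hom C (Dom C b) Z" "\<iota>\<^sub>2 \<cdot> b = f \<cdot> z\<^sub>2"
    using pb1 pb2 \<iota> f unfolding is_pullback_def hom_def by auto
  have "is_binary_coproduct C (Dom C a) (Dom C b) Z z\<^sub>1 z\<^sub>2"
    using extensive[OF P 1(2) 2(2) 1(1) f 2(1) 1(3) 2(3)] pb1 pb2 by blast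
  with pb1 pb2 that show thesis by blast
qed

end

section \<open>Sieves and topologies\<close>

context category
begin

lemma sieve_hom: "\<lbrakk>is_sieve C X S; f \<in> S\<rbrakk> \<Longrightarrow> f \<in> hom C (Dom C f) X"
  by (auto simp: is_sieve_def hom_def)

lemma sieve_closed: "\<lbrakk>is_sieve C X S; f \<in> S; f \<in> hom C Y X; g \<in> hom C V Y\<rbrakk> \<Longrightarrow> f \<cdot> g \<in> S"
  by (auto simp: is_sieve_def hom_def)

lemma mem_pullback_sieve:
  "f \<in> hom C Y X \<Longrightarrow> g \<in> pullback_sieve C f S \<longleftrightarrow> g \<in> hom C (Dom C g) Y \<and> f \<cdot> g \<in> S"
  by (auto simp: pullback_sieve_def hom_def)

lemma pullback_sieve_is_sieve: "\<lbrakk>is_sieve C X S; f \<in> hom C Y X\<rbrakk> \<Longrightarrow> is_sieve C Y (pullback_sieve C f S)"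
  using sieves_topology(1) unfolding grothendieck_topology_def by blast

lemma pullback_sieve_Comp:
  assumes f: "f \<in> hom C Y X" and g: "g \<in> hom C V Y"
  shows "pullback_sieve C (f \<cdot> g) S = pullback_sieve C g (pullback_sieve C f S)"
proof (rule set_eqI)
  fix k
  show "k \<in> pullback_sieve C (f \<cdot> g) S \<longleftrightarrow> k \<in> pullback_sieve C g (pullback_sieve C f S)"
    using Comp_assoc[OF _ g f, of k "Dom C k"] Comp_hom[OF _ g, of k "Dom C k"]
    unfolding mem_pullback_sieve[OF Comp_hom[OF g f]] mem_pullback_sieve[OF g] mem_pullback_sieve[OF f]
    by (auto simp: hom_def)
qed

lemma pullback_sieve_Id:
  assumes S: "is_sieve C X S"
  shows "pullback_sieve C (Id C X) S = S"
proof (rule set_eqI)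
  fix f
  have id: "Id C X \<in> hom C X X" using S Id_hom by (simp add: is_sieve_def)
  show "f \<in> pullback_sieve C (Id C X) S \<longleftrightarrow> f \<in> S"
    unfolding mem_pullback_sieve[OF id] using Id_Comp[of f "Dom C f" X] sieve_hom[OF S, of f] by auto
qed

lemma pullback_sieve_of_member:
  assumes S: "is_sieve C X S" and f: "f \<in> S" "f \<in> hom C Y X"
  shows "pullback_sieve C f S = maximal_sieve C Y"
  using sieve_closed[OF S f] by (auto simp: mem_pullback_sieve[OF f(2)] maximal_sieve_def hom_def)

lemma pullback_maximal_sieve:
  assumes f: "f \<in> hom C Y X"
  shows "pullback_sieve C f (maximal_sieve C X) = maximal_sieve C Y"
  using Comp_hom[OF _ f] by (auto simp: mem_pullback_sieve[OF f] maximal_sieve_def hom_def)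

text \<open>A form of membership in which the middle objects \<open>T i\<close> are named, so that the factor \<open>g\<close>
  can be used as an arrow between known objects.\<close>
lemma mem_generated_sieve:
  assumes "\<And>i. i \<in> I \<Longrightarrow> \<iota> i \<in> hom C (T i) X"
  shows "f \<in> generated_sieve C (\<iota> ` I) \<longleftrightarrow> (\<exists>i\<in>I. \<exists>g\<in>hom C (Dom C f) (T i). f = \<iota> i \<cdot> g)"
proof -
  have "Dom C (\<iota> i \<cdot> g) = Dom C g \<and> Dom C (\<iota> i) = T i" if "i \<in> I" "g \<in> Arr C" "Cod C g = Dom C (\<iota> i)" for i g
    using assms[OF that(1)] Comp_hom[OF _ assms[OF that(1)], of g "Dom C g"] that by (auto simp: hom_def)
  moreover have "Dom C (\<iota> i) = T i" if "i \<in> I" for i using assms[OF that] by (simp add: hom_def)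
  ultimately show ?thesis unfolding generated_sieve_def hom_def by fastforce
qed

lemma coproduct_sieve:
  assumes "is_coproduct C I T X \<iota>"
  shows "is_sieve C X (generated_sieve C (\<iota> ` I))"
  using assms by (intro generated_sieve_is_sieve) (auto simp: is_coproduct_def hom_def)

lemma mem_coproduct_sieve:
  assumes "is_coproduct C I T X \<iota>"
  shows "f \<in> generated_sieve C (\<iota> ` I) \<longleftrightarrow> (\<exists>i\<in>I. \<exists>g\<in>hom C (Dom C f) (T i). f = \<iota> i \<cdot> g)"
  by (rule mem_generated_sieve[where X = X]) (use assms in \<open>simp add: is_coproduct_def\<close>)

lemma coprojection_mem_coproduct_sieve:
  assumes X: "is_coproduct C I T X \<iota>" and i: "i \<in> I"
  shows "\<iota> i \<in> generated_sieve C (\<iota> ` I)"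
proof -
  have \<iota>: "\<iota> i \<in> hom C (T i) X" and "T i \<in> Obj C" using assms by (auto simp: is_coproduct_def)
  then have "Id C (T i) \<in> hom C (Dom C (\<iota> i)) (T i)" using Id_hom by (auto simp: hom_def)
  then show ?thesis unfolding mem_coproduct_sieve[OF X] using Comp_Id[OF \<iota>] i by metis
qed

text \<open>An arrow \<open>g\<close> with \<open>f g\<close> factoring through \<open>\<iota>\<^sub>i\<close> is the same as an arrow factoring
  through the pullback of \<open>\<iota>\<^sub>i\<close> along \<open>f\<close>.\<close>
lemma pullback_generated_sieve:
  assumes \<iota>: "\<And>i. i \<in> I \<Longrightarrow> \<iota> i \<in> hom C (T i) X" and f: "f \<in> hom C Y X"
    and pb: "\<And>i. i \<in> I \<Longrightarrow> is_pullback C (p i) (q i) (\<iota> i) f"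
  shows "pullback_sieve C f (generated_sieve C (\<iota> ` I)) = generated_sieve C (q ` I)"
proof -
  define W where "W i = Dom C (p i)" for i
  have p: "p i \<in> hom C (W i) (T i)" and q: "q i \<in> hom C (W i) Y" and comm: "\<iota> i \<cdot> p i = f \<cdot> q i"
    if "i \<in> I" for i
    using pb[OF that] \<iota>[OF that] f unfolding is_pullback_def hom_def W_def by auto
  have "(\<exists>i\<in>I. \<exists>k\<in>hom C (Dom C (f \<cdot> g)) (T i). f \<cdot> g = \<iota> i \<cdot> k) \<longleftrightarrow>
        (\<exists>i\<in>I. \<exists>k\<in>hom C (Dom C g) (W i). g = q i \<cdot> k)" (is "?L \<longleftrightarrow> ?R")
    if g: "g \<in> hom C (Dom C g) Y" for g
  proof
    have fg: "Dom C (f \<cdot> g) = Dom C g" using Comp_hom[OF g f] by (simp add: hom_def)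
    assume ?L
    then obtain i k where i: "i \<in> I" and k: "k \<in> hom C (Dom C g) (T i)" and "\<iota> i \<cdot> k = f \<cdot> g"
      using fg by auto
    then obtain h where "h \<in> hom C (Dom C g) (W i)" "q i \<cdot> h = g"
      using pullback_lift[OF pb[OF i] p[OF i] q[OF i] \<iota>[OF i] f k g] by blast
    with i show ?R by blast
  next
    have fg: "Dom C (f \<cdot> g) = Dom C g" using Comp_hom[OF g f] by (simp add: hom_def)
    assume ?R
    then obtain i k where i: "i \<in> I" and k: "k \<in> hom C (Dom C g) (W i)" and gk: "g = q i \<cdot> k" by blast
    have "f \<cdot> g = \<iota> i \<cdot> (p i \<cdot> k)"
      unfolding gk using Comp_assoc[OF k q[OF i] f] Comp_assoc[OF k p[OF i] \<iota>[OF i]] comm[OF i] by simp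
    then show ?L using i Comp_hom[OF k p[OF i]] fg by auto
  qed
  moreover have "g \<in> hom C (Dom C g) Y" if "i \<in> I" "k \<in> hom C (Dom C g) (W i)" "g = q i \<cdot> k" for g i k
    using that Comp_hom[OF that(2) q] by simp
  moreover have "f' \<in> generated_sieve C (\<iota> ` I) \<longleftrightarrow> (\<exists>i\<in>I. \<exists>k\<in>hom C (Dom C f') (T i). f' = \<iota> i \<cdot> k)" for f'
    by (rule mem_generated_sieve[OF \<iota>])
  moreover have "g \<in> generated_sieve C (q ` I) \<longleftrightarrow> (\<exists>i\<in>I. \<exists>k\<in>hom C (Dom C g) (W i). g = q i \<cdot> k)" for g
    by (rule mem_generated_sieve[OF q])
  ultimately show ?thesis
    unfolding set_eq_iff mem_pullback_sieve[OF f] by metis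
qed

lemma topology_superset:
  assumes J: "grothendieck_topology C J" and S: "S \<in> J X" and R: "is_sieve C X R" "S \<subseteq> R"
  shows "R \<in> J X"
proof -
  have max: "\<And>Y. Y \<in> Obj C \<Longrightarrow> maximal_sieve C Y \<in> J Y"
    and trans: "\<lbrakk>S \<in> J X; is_sieve C X R; \<forall>f\<in>S. pullback_sieve C f R \<in> J (Dom C f)\<rbrakk> \<Longrightarrow> R \<in> J X"
    using J unfolding grothendieck_topology_def by blast+
  have "pullback_sieve C f R \<in> J (Dom C f)" if "f \<in> S" for f
  proof -
    have f: "f \<in> R" using that R by blast
    from sieve_hom[OF R(1) f] have fh: "f \<in> hom C (Dom C f) X" .
    show ?thesis using pullback_sieve_of_member[OF R(1) f fh] max hom_Obj[OF fh] by simp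
  qed
  then show ?thesis using trans S R by blast
qed

end

text \<open>Induction on the number of summands. Writing \<open>X = T\<^sub>i + R\<close>, the sieve generated by \<open>\<iota>\<^sub>i\<close> and \<open>\<rho>\<close> covers.
  The sieve of the full coproduct pulls back along \<open>\<iota>\<^sub>i\<close> to the maximal sieve, and along
  \<open>\<rho>\<close> to one containing the coproduct sieve of \<open>R\<close>, which covers by induction; so it
  covers by transitivity. This spares proving that arbitrary finite coproducts are stable
  under pullback.\<close>
lemma (in finitary_extensive) covers_finite_coproductsI:
  assumes J: "grothendieck_topology C J"
    and empty: "\<And>Z. is_initial C Z \<Longrightarrow> {} \<in> J Z"
    and binary: "\<And>X Y P \<iota>\<^sub>1 \<iota>\<^sub>2. is_binary_coproduct C X Y P \<iota>\<^sub>1 \<iota>\<^sub>2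
      \<Longrightarrow> generated_sieve C {\<iota>\<^sub>1, \<iota>\<^sub>2} \<in> J P"
  shows "covers_finite_coproducts C J"
proof -
  have max: "\<And>Y. Y \<in> Obj C \<Longrightarrow> maximal_sieve C Y \<in> J Y"
    and stable: "\<And>X Y S f. S \<in> J X \<Longrightarrow> f \<in> hom C Y X \<Longrightarrow> pullback_sieve C f S \<in> J Y"
    and trans: "\<And>X R S. \<lbrakk>S \<in> J X; is_sieve C X R; \<forall>f\<in>S. pullback_sieve C f R \<in> J (Dom C f)\<rbrakk> \<Longrightarrow> R \<in> J X"
    using J unfolding grothendieck_topology_def by blast+
  have "generated_sieve C (\<iota> ` I) \<in> J X"
    if "finite I" "is_coproduct C I T X \<iota>" for I :: "nat set" and T X \<iota>
    using that
  proof (induction I arbitrary: X \<iota> rule: finite_induct)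
    case empty
    then show ?case
      using assms(2)[of X] is_coproduct_empty_iff[of C T X \<iota>] by (simp add: generated_sieve_def)
  next
    case (insert i I)
    note X = insert.prems
    have TO: "\<forall>j\<in>I. T j \<in> Obj C" and \<iota>: "\<And>j. j \<in> insert i I \<Longrightarrow> \<iota> j \<in> hom C (T j) X"
      using X by (auto simp: is_coproduct_def)
    obtain R \<kappa> where R: "is_coproduct C I T R \<kappa>"
      using has_finite_coproducts[OF insert.hyps(1) TO] by blast
    have \<kappa>: "\<And>j. j \<in> I \<Longrightarrow> \<kappa> j \<in> hom C (T j) R" using R by (auto simp: is_coproduct_def)
    obtain \<rho> where \<rho>: "\<rho> \<in> hom C R X" and \<rho>\<kappa>: "\<forall>j\<in>I. \<rho> \<cdot> \<kappa> j = \<iota> j"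
      and P: "is_binary_coproduct C (T i) R X (\<iota> i) \<rho>"
      by (rule coproduct_split[OF X insert.hyps(2) R])
    let ?S = "generated_sieve C (\<iota> ` insert i I)"
    have S: "is_sieve C X ?S" by (rule coproduct_sieve[OF X])
    have \<iota>i: "\<iota> i \<in> ?S" using coprojection_mem_coproduct_sieve[OF X] by blast
    have \<rho>S: "pullback_sieve C \<rho> ?S \<in> J R"
    proof (rule topology_superset[OF J insert.IH[OF R] pullback_sieve_is_sieve[OF S \<rho>]])
      show "generated_sieve C (\<kappa> ` I) \<subseteq> pullback_sieve C \<rho> ?S"
      proof
        fix g assume "g \<in> generated_sieve C (\<kappa> ` I)"
        then obtain j k where j: "j \<in> I" and k: "k \<in> hom C (Dom C g) (T j)" and g: "g = \<kappa> j \<cdot> k"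
          using mem_coproduct_sieve[OF R] by auto
        have "\<rho> \<cdot> g = \<iota> j \<cdot> k" using g Comp_assoc[OF k \<kappa>[OF j] \<rho>] bspec[OF \<rho>\<kappa> j] by simp
        moreover have "\<iota> j \<in> ?S" using coprojection_mem_coproduct_sieve[OF X] j by blast
        ultimately have "\<rho> \<cdot> g \<in> ?S" using sieve_closed[OF S _ \<iota> k] j by simp
        then show "g \<in> pullback_sieve C \<rho> ?S"
          unfolding mem_pullback_sieve[OF \<rho>] using Comp_hom[OF k \<kappa>[OF j]] g by simp
      qed
    qed
    show ?case
    proof (rule trans[OF binary[OF P] S], intro ballI)
      fix f assume "f \<in> generated_sieve C {\<iota> i, \<rho>}"
      then obtain c g where c: "c = \<iota> i \<or> c = \<rho>" and g: "g \<in> hom C (Dom C g) (Dom C c)"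
        and f: "f = c \<cdot> g"
        unfolding generated_sieve_def hom_def by auto
      have ch: "c \<in> hom C (Dom C c) X" using c \<iota>[of i] \<rho> by (auto simp: hom_def)
      have "pullback_sieve C c ?S \<in> J (Dom C c)"
        using c
      proof
        assume "c = \<iota> i"
        then show ?thesis
          using pullback_sieve_of_member[OF S _ ch] \<iota>i max hom_Obj[OF ch] by simp
      next
        assume "c = \<rho>"
        then show ?thesis using \<rho>S \<rho> by (simp add: hom_def)
      qed
      then have "pullback_sieve C f ?S \<in> J (Dom C g)"
        unfolding f pullback_sieve_Comp[OF ch g] using stable g by blast
      moreover have "Dom C f = Dom C g" using Comp_hom[OF g ch] f by (simp add: hom_def)
      ultimately show "pullback_sieve C f ?S \<in> J (Dom C f)" by simp
    qed
  qed
  then show ?thesis unfolding covers_finite_coproducts_def by blast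
qed

section \<open>The topology of universally effective sieves of a presheaf\<close>

definition sheaf_for :: "('o, 'a) category \<Rightarrow> ('o, 'a, 'x) presheaf \<Rightarrow> 'o \<Rightarrow> 'a set \<Rightarrow> bool" where
  "sheaf_for C F X S \<longleftrightarrow> (\<forall>s. matching_family C F S s \<longrightarrow>
     (\<exists>!x. x \<in> Sections F X \<and> (\<forall>f\<in>S. Restrict F f x = s f)))"

lemma is_sheaf_iff: "is_sheaf C J F \<longleftrightarrow> (\<forall>X\<in>Obj C. \<forall>S\<in>J X. sheaf_for C F X S)"
  by (simp add: is_sheaf_def sheaf_for_def)

text \<open>The finest topology for which \<open>F\<close> is a sheaf. Gluing is required along every pullback of
  the sieve, since gluing along the sieve alone is not a pullback-stable property.\<close>
definition sheaf_topology :: "('o, 'a) category \<Rightarrow> ('o, 'a, 'x) presheaf \<Rightarrow> 'o \<Rightarrow> 'a set set" where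
  "sheaf_topology C F X =
     {S. is_sieve C X S \<and> (\<forall>Y. \<forall>f\<in>hom C Y X. sheaf_for C F Y (pullback_sieve C f S))}"

context presheaf
begin

lemma Restrict_in: "\<lbrakk>f \<in> hom C X Y; x \<in> Sections F Y\<rbrakk> \<Longrightarrow> Restrict F f x \<in> Sections F X"
  using Restrict_maps by blast

lemma matching_familyD:
  assumes "matching_family C F S s" "f \<in> S" "f \<in> hom C Y X"
  shows "s f \<in> Sections F Y" and "\<And>g V. g \<in> hom C V Y \<Longrightarrow> s (f \<cdot> g) = Restrict F g (s f)"
  using assms unfolding matching_family_def hom_def by auto

lemma matching_familyI:
  assumes S: "is_sieve C X S"
    and "\<And>f Y. \<lbrakk>f \<in> S; f \<in> hom C Y X\<rbrakk> \<Longrightarrow> s f \<in> Sections F Y"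
    and "\<And>f g Y V. \<lbrakk>f \<in> S; f \<in> hom C Y X; g \<in> hom C V Y\<rbrakk> \<Longrightarrow> s (f \<cdot> g) = Restrict F g (s f)"
  shows "matching_family C F S s"
  unfolding matching_family_def
proof (intro conjI ballI impI)
  fix f assume f: "f \<in> S"
  show "s f \<in> Sections F (Dom C f)" using assms(2)[OF f sieve_hom[OF S f]] .
  fix g assume "g \<in> Arr C" "Cod C g = Dom C f"
  then show "s (f \<cdot> g) = Restrict F g (s f)"
    using assms(3)[OF f sieve_hom[OF S f], of g "Dom C g"] by (simp add: hom_def)
qed

lemma matching_family_of_section:
  assumes S: "is_sieve C X S" and x: "x \<in> Sections F X"
  shows "matching_family C F S (\<lambda>f. Restrict F f x)"
  by (rule matching_familyI[OF S]) (use Restrict_in Restrict_Comp x in blast)+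

lemma matching_family_pullback:
  assumes S: "is_sieve C X S" and s: "matching_family C F S s" and f: "f \<in> hom C Y X"
  shows "matching_family C F (pullback_sieve C f S) (\<lambda>g. s (f \<cdot> g))"
proof (rule matching_familyI[OF pullback_sieve_is_sieve[OF S f]])
  fix g V assume "g \<in> pullback_sieve C f S" and g: "g \<in> hom C V Y"
  then have fg: "f \<cdot> g \<in> S" by (simp add: mem_pullback_sieve[OF f])
  note fgh = Comp_hom[OF g f]
  show "s (f \<cdot> g) \<in> Sections F V" by (rule matching_familyD(1)[OF s fg fgh])
  fix k U assume k: "k \<in> hom C U V"
  show "s (f \<cdot> (g \<cdot> k)) = Restrict F k (s (f \<cdot> g))"
    using matching_familyD(2)[OF s fg fgh k] Comp_assoc[OF k g f] by simp
qed

lemma sheaf_forD_separated: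
  assumes "sheaf_for C F X S" "is_sieve C X S" "x \<in> Sections F X" "y \<in> Sections F X"
    and "\<And>f. f \<in> S \<Longrightarrow> Restrict F f x = Restrict F f y"
  shows "x = y"
proof -
  have "\<exists>!z. z \<in> Sections F X \<and> (\<forall>f\<in>S. Restrict F f z = Restrict F f x)"
    using assms(1) matching_family_of_section[OF assms(2,3)] unfolding sheaf_for_def by blast
  then show ?thesis using assms(3-5) by metis
qed

lemma sheaf_for_maximal_sieve:
  assumes X: "X \<in> Obj C"
  shows "sheaf_for C F X (maximal_sieve C X)"
  unfolding sheaf_for_def
proof (intro allI impI)
  fix s assume s: "matching_family C F (maximal_sieve C X) s"
  have id: "Id C X \<in> hom C X X" "Id C X \<in> maximal_sieve C X"
    using Id_hom[OF X] by (auto simp: maximal_sieve_def hom_def)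
  have "s (Id C X) \<in> Sections F X" using matching_familyD(1)[OF s id(2,1)] .
  moreover have "Restrict F f (s (Id C X)) = s f" if "f \<in> maximal_sieve C X" for f
  proof -
    have f: "f \<in> hom C (Dom C f) X" using that by (auto simp: maximal_sieve_def hom_def)
    show ?thesis using matching_familyD(2)[OF s id(2,1) f] Id_Comp[OF f] by simp
  qed
  moreover have "x = s (Id C X)" if "x \<in> Sections F X" "\<forall>f\<in>maximal_sieve C X. Restrict F f x = s f" for x
    using that Restrict_Id[OF X that(1)] id by auto
  ultimately show "\<exists>!x. x \<in> Sections F X \<and> (\<forall>f\<in>maximal_sieve C X. Restrict F f x = s f)" by blast
qed

text \<open>The heart of the transitivity axiom. A matching family on \<open>R\<close> is first glued along each
  \<open>f\<^sup>*R\<close> with \<open>f \<in> S\<close>, and the resulting sections, which match by uniqueness, are glued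
  along \<open>S\<close>. That the result restricts correctly to an arrow \<open>r\<close> of \<open>R\<close> is tested on the
  sieve \<open>r\<^sup>*S\<close>; for this reason unique gluing is assumed along all pullbacks of \<open>S\<close>.\<close>
lemma sheaf_for_transitive:
  assumes S: "is_sieve C X S" and R: "is_sieve C X R"
    and shS: "\<And>Y f. f \<in> hom C Y X \<Longrightarrow> sheaf_for C F Y (pullback_sieve C f S)"
    and shR: "\<And>Y f. \<lbrakk>f \<in> S; f \<in> hom C Y X\<rbrakk> \<Longrightarrow> sheaf_for C F Y (pullback_sieve C f R)"
  shows "sheaf_for C F X R"
  unfolding sheaf_for_def
proof (intro allI impI)
  fix s assume s: "matching_family C F R s"
  have X: "X \<in> Obj C" using S by (simp add: is_sieve_def)
  have shX: "sheaf_for C F X S" using shS[OF Id_hom[OF X]] pullback_sieve_Id[OF S] by simp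
  define glue where
    "glue f = (THE x. x \<in> Sections F (Dom C f) \<and>
       (\<forall>g\<in>pullback_sieve C f R. Restrict F g x = s (f \<cdot> g)))" for f
  have glue_ex: "\<exists>!x. x \<in> Sections F Y \<and> (\<forall>g\<in>pullback_sieve C f R. Restrict F g x = s (f \<cdot> g))"
    if f: "f \<in> S" "f \<in> hom C Y X" for f Y
    using shR[OF f] matching_family_pullback[OF R s f(2)] unfolding sheaf_for_def by blast
  have glue: "glue f \<in> Sections F Y \<and> (\<forall>g\<in>pullback_sieve C f R. Restrict F g (glue f) = s (f \<cdot> g))"
    if f: "f \<in> S" "f \<in> hom C Y X" for f Y
  proof -
    have "Dom C f = Y" using f(2) by (simp add: hom_def)
    then show ?thesis using theI'[OF glue_ex[OF f]] unfolding glue_def by simp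
  qed
  have "matching_family C F S glue"
  proof (rule matching_familyI[OF S])
    fix f Y assume f: "f \<in> S" "f \<in> hom C Y X"
    show "glue f \<in> Sections F Y" using glue[OF f] by blast
    fix k V assume k: "k \<in> hom C V Y"
    have fk: "f \<cdot> k \<in> S" "f \<cdot> k \<in> hom C V X"
      using sieve_closed[OF S f k] Comp_hom[OF k f(2)] by auto
    have "Restrict F g (Restrict F k (glue f)) = s ((f \<cdot> k) \<cdot> g)"
      if g: "g \<in> pullback_sieve C (f \<cdot> k) R" for g
    proof -
      have gh: "g \<in> hom C (Dom C g) V" and R': "(f \<cdot> k) \<cdot> g \<in> R"
        using g unfolding mem_pullback_sieve[OF fk(2)] by auto
      note assoc = Comp_assoc[OF gh k f(2)]
      have "k \<cdot> g \<in> pullback_sieve C f R"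
        unfolding mem_pullback_sieve[OF f(2)] using R' assoc Comp_hom[OF gh k] by (auto simp: hom_def)
      then have "Restrict F (k \<cdot> g) (glue f) = s ((f \<cdot> k) \<cdot> g)" using glue[OF f] assoc by simp
      then show ?thesis using Restrict_Comp[OF gh k] glue[OF f] by simp
    qed
    then show "glue (f \<cdot> k) = Restrict F k (glue f)"
      using glue_ex[OF fk] glue[OF fk] glue[OF f] Restrict_in[OF k] by blast
  qed
  then obtain x where x: "x \<in> Sections F X" and xS: "\<And>f. f \<in> S \<Longrightarrow> Restrict F f x = glue f"
    using shX unfolding sheaf_for_def by blast
  have "Restrict F r x = s r" if r: "r \<in> R" for r
  proof -
    define V where "V = Dom C r"
    have rh: "r \<in> hom C V X" using sieve_hom[OF R r] by (simp add: V_def)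
    show ?thesis
    proof (rule sheaf_forD_separated[OF shS[OF rh] pullback_sieve_is_sieve[OF S rh]])
      show "Restrict F r x \<in> Sections F V" using Restrict_in[OF rh x] .
      show "s r \<in> Sections F V" using matching_familyD(1)[OF s r rh] .
      fix g assume g: "g \<in> pullback_sieve C r S"
      define U where "U = Dom C g"
      have gh: "g \<in> hom C U V" and rgS: "r \<cdot> g \<in> S"
        using g unfolding mem_pullback_sieve[OF rh] U_def by auto
      note rg = Comp_hom[OF gh rh]
      have UO: "U \<in> Obj C" using hom_Obj[OF gh] by blast
      \<comment> \<open>as \<open>r g\<close> already lies in \<open>R\<close>, the section glued over it is the given one\<close>
      have "Id C U \<in> pullback_sieve C (r \<cdot> g) R"
        unfolding mem_pullback_sieve[OF rg] using Id_hom[OF UO] Comp_Id[OF rg] sieve_closed[OF R r rh gh]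
        by (auto simp: hom_def)
      then have "glue (r \<cdot> g) = s (r \<cdot> g)"
        using glue[OF rgS rg] Restrict_Id[OF UO] Comp_Id[OF rg] by metis
      then show "Restrict F g (Restrict F r x) = Restrict F g (s r)"
        using Restrict_Comp[OF gh rh x] xS[OF rgS] matching_familyD(2)[OF s r rh gh] by simp
    qed
  qed
  moreover have "y = x" if y: "y \<in> Sections F X" "\<forall>r\<in>R. Restrict F r y = s r" for y
  proof (rule sheaf_forD_separated[OF shX S y(1) x])
    fix f assume f: "f \<in> S"
    note fh = sieve_hom[OF S f]
    have "Restrict F g (Restrict F f y) = s (f \<cdot> g)" if "g \<in> pullback_sieve C f R" for g
      using that Restrict_Comp[OF _ fh y(1), of g "Dom C g"] y(2) unfolding mem_pullback_sieve[OF fh] by auto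
    then show "Restrict F f y = Restrict F f x"
      using glue_ex[OF f fh] glue[OF f fh] Restrict_in[OF fh y(1)] xS[OF f] by metis
  qed
  ultimately show "\<exists>!x. x \<in> Sections F X \<and> (\<forall>r\<in>R. Restrict F r x = s r)" using x by blast
qed

lemma sheaf_topology_topology: "grothendieck_topology C (sheaf_topology C F)"
  unfolding grothendieck_topology_def
proof (intro conjI allI ballI impI)
  fix X S assume "S \<in> sheaf_topology C F X"
  then show "is_sieve C X S" by (simp add: sheaf_topology_def)
next
  fix X assume "X \<in> Obj C"
  then have "is_sieve C X (maximal_sieve C X)"
    using sieves_topology(1) unfolding grothendieck_topology_def by blast
  moreover have "sheaf_for C F Y (pullback_sieve C f (maximal_sieve C X))" if "f \<in> hom C Y X" for Y f
    using pullback_maximal_sieve[OF that] sheaf_for_maximal_sieve hom_Obj[OF that] by simp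
  ultimately show "maximal_sieve C X \<in> sheaf_topology C F X" by (simp add: sheaf_topology_def)
next
  fix X Y S f assume S: "S \<in> sheaf_topology C F X" and f: "f \<in> hom C Y X"
  have "sheaf_for C F V (pullback_sieve C g (pullback_sieve C f S))" if g: "g \<in> hom C V Y" for V g
    unfolding pullback_sieve_Comp[OF f g, symmetric]
    using S Comp_hom[OF g f] by (simp add: sheaf_topology_def)
  then show "pullback_sieve C f S \<in> sheaf_topology C F Y"
    using S pullback_sieve_is_sieve[OF _ f] by (simp add: sheaf_topology_def)
next
  fix X R S assume S: "S \<in> sheaf_topology C F X"
    and "is_sieve C X R \<and> (\<forall>f\<in>S. pullback_sieve C f R \<in> sheaf_topology C F (Dom C f))"
  then have R: "is_sieve C X R"
    and loc: "\<And>f. f \<in> S \<Longrightarrow> pullback_sieve C f R \<in> sheaf_topology C F (Dom C f)" by auto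
  have Ss: "is_sieve C X S" using S by (simp add: sheaf_topology_def)
  have "sheaf_for C F Y (pullback_sieve C h R)" if h: "h \<in> hom C Y X" for Y h
  proof (rule sheaf_for_transitive[OF pullback_sieve_is_sieve[OF Ss h] pullback_sieve_is_sieve[OF R h]])
    fix V f assume f: "f \<in> hom C V Y"
    note hf = Comp_hom[OF f h]
    show "sheaf_for C F V (pullback_sieve C f (pullback_sieve C h S))"
      unfolding pullback_sieve_Comp[OF h f, symmetric] using S hf by (simp add: sheaf_topology_def)
    assume "f \<in> pullback_sieve C h S"
    then have "h \<cdot> f \<in> S" by (simp add: mem_pullback_sieve[OF h])
    from loc[OF this] have mem: "pullback_sieve C (h \<cdot> f) R \<in> sheaf_topology C F V"
      using hf by (simp add: hom_def)
    have VO: "V \<in> Obj C" using hom_Obj[OF f] by blast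
    have "sheaf_for C F V (pullback_sieve C (Id C V) (pullback_sieve C (h \<cdot> f) R))"
      using mem Id_hom[OF VO] by (simp add: sheaf_topology_def)
    then show "sheaf_for C F V (pullback_sieve C f (pullback_sieve C h R))"
      using pullback_sieve_Id[OF pullback_sieve_is_sieve[OF R hf]] pullback_sieve_Comp[OF h f] by simp
  qed
  with R show "R \<in> sheaf_topology C F X" by (simp add: sheaf_topology_def)
qed

section \<open>Sections over a coproduct\<close>

text \<open>A matching family is determined by its values on the generators, because its value on
  \<open>\<iota>\<^sub>i g\<close> is the restriction along \<open>g\<close> of its value on \<open>\<iota>\<^sub>i\<close>.\<close>
lemma sheaf_for_coproduct_sieve:
  assumes X: "is_coproduct C I T X \<iota>"
    and bij: "bij_betw (\<lambda>x. \<lambda>i\<in>I. Restrict F (\<iota> i) x) (Sections F X) (\<Pi>\<^sub>E i\<in>I. Sections F (T i))"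
  shows "sheaf_for C F X (generated_sieve C (\<iota> ` I))"
  unfolding sheaf_for_def
proof (intro allI impI)
  let ?S = "generated_sieve C (\<iota> ` I)"
  fix s assume s: "matching_family C F ?S s"
  have \<iota>: "\<And>i. i \<in> I \<Longrightarrow> \<iota> i \<in> hom C (T i) X" using X by (simp add: is_coproduct_def)
  have gen: "\<And>i. i \<in> I \<Longrightarrow> \<iota> i \<in> ?S" by (rule coprojection_mem_coproduct_sieve[OF X])
  have "(\<lambda>i\<in>I. s (\<iota> i)) \<in> (\<Pi>\<^sub>E i\<in>I. Sections F (T i))"
    using matching_familyD(1)[OF s gen \<iota>] by auto
  then obtain x where x: "x \<in> Sections F X"
    and eq: "(\<lambda>i\<in>I. Restrict F (\<iota> i) x) = (\<lambda>i\<in>I. s (\<iota> i))"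
    using bij unfolding bij_betw_def by (metis (no_types, lifting) imageE)
  have xi: "Restrict F (\<iota> i) x = s (\<iota> i)" if "i \<in> I" for i
    using fun_cong[OF eq, of i] that by simp
  have "Restrict F f x = s f" if "f \<in> ?S" for f
  proof -
    obtain i g where i: "i \<in> I" and g: "g \<in> hom C (Dom C f) (T i)" and f: "f = \<iota> i \<cdot> g"
      using \<open>f \<in> ?S\<close> mem_coproduct_sieve[OF X] by auto
    show ?thesis
      using Restrict_Comp[OF g \<iota>[OF i] x] xi[OF i] matching_familyD(2)[OF s gen[OF i] \<iota>[OF i] g] f by simp
  qed
  moreover have "y = x" if "y \<in> Sections F X" "\<forall>f\<in>?S. Restrict F f y = s f" for y
  proof -
    have "(\<lambda>i\<in>I. Restrict F (\<iota> i) y) = (\<lambda>i\<in>I. Restrict F (\<iota> i) x)"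
      using that gen xi by (intro restrict_ext) auto
    then show ?thesis using bij that(1) x unfolding bij_betw_def by (auto dest: inj_onD)
  qed
  ultimately show "\<exists>!x. x \<in> Sections F X \<and> (\<forall>f\<in>?S. Restrict F f x = s f)" using x by blast
qed

text \<open>Surjectivity requires extending a tuple \<open>(t\<^sub>i)\<close> to the sieve by sending
  \<open>\<iota>\<^sub>i g\<close> to the restriction of \<open>t\<^sub>i\<close> along \<open>g\<close>. The compatibility hypothesis says that
  this does not depend on the chosen factorization.\<close>
lemma coproduct_sections_bij:
  assumes X: "is_coproduct C I T X \<iota>" and sh: "sheaf_for C F X (generated_sieve C (\<iota> ` I))"
    and compat: "\<And>t i j V u v. \<lbrakk>\<And>i. i \<in> I \<Longrightarrow> t i \<in> Sections F (T i); i \<in> I; j \<in> I;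
       u \<in> hom C V (T i); v \<in> hom C V (T j); \<iota> i \<cdot> u = \<iota> j \<cdot> v\<rbrakk>
       \<Longrightarrow> Restrict F u (t i) = Restrict F v (t j)"
  shows "bij_betw (\<lambda>x. \<lambda>i\<in>I. Restrict F (\<iota> i) x) (Sections F X) (\<Pi>\<^sub>E i\<in>I. Sections F (T i))"
    (is "bij_betw ?r _ ?P")
proof -
  let ?S = "generated_sieve C (\<iota> ` I)"
  have \<iota>: "\<And>i. i \<in> I \<Longrightarrow> \<iota> i \<in> hom C (T i) X" using X by (simp add: is_coproduct_def)
  note gen = coprojection_mem_coproduct_sieve[OF X]
  note mem = mem_coproduct_sieve[OF X]
  have S: "is_sieve C X ?S" by (rule coproduct_sieve[OF X])
  have "inj_on ?r (Sections F X)"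
  proof (rule inj_onI)
    fix x y assume x: "x \<in> Sections F X" and y: "y \<in> Sections F X" and eq: "?r x = ?r y"
    have xy: "Restrict F (\<iota> i) x = Restrict F (\<iota> i) y" if "i \<in> I" for i
      using fun_cong[OF eq, of i] that by simp
    show "x = y"
    proof (rule sheaf_forD_separated[OF sh S x y])
      fix f assume "f \<in> ?S"
      then obtain i g where i: "i \<in> I" and g: "g \<in> hom C (Dom C f) (T i)" and f: "f = \<iota> i \<cdot> g"
        using mem by auto
      show "Restrict F f x = Restrict F f y"
        unfolding f Restrict_Comp[OF g \<iota>[OF i] x] Restrict_Comp[OF g \<iota>[OF i] y] xy[OF i] ..
    qed
  qed
  moreover have "?r ` Sections F X \<subseteq> ?P" using Restrict_in[OF \<iota>] by auto
  moreover have "?P \<subseteq> ?r ` Sections F X"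
  proof
    fix t assume t: "t \<in> ?P"
    then have tI: "\<And>i. i \<in> I \<Longrightarrow> t i \<in> Sections F (T i)" by auto
    define s where "s f = (SOME y. \<exists>i\<in>I. \<exists>g\<in>hom C (Dom C f) (T i). f = \<iota> i \<cdot> g \<and> y = Restrict F g (t i))" for f
    have s_eq: "s (\<iota> i \<cdot> g) = Restrict F g (t i)" if i: "i \<in> I" and g: "g \<in> hom C V (T i)" for i g V
    proof -
      have d: "Dom C (\<iota> i \<cdot> g) = V" using Comp_hom[OF g \<iota>[OF i]] by (simp add: hom_def)
      show ?thesis
        unfolding s_def d
      proof (rule some_equality)
        show "\<exists>j\<in>I. \<exists>k\<in>hom C V (T j). \<iota> i \<cdot> g = \<iota> j \<cdot> k \<and> Restrict F g (t i) = Restrict F k (t j)"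
          using i g by blast
        fix y assume "\<exists>j\<in>I. \<exists>k\<in>hom C V (T j). \<iota> i \<cdot> g = \<iota> j \<cdot> k \<and> y = Restrict F k (t j)"
        then show "y = Restrict F g (t i)" using compat[OF tI i _ g] by metis
      qed
    qed
    have "matching_family C F ?S s"
    proof (rule matching_familyI[OF S])
      fix f Y assume f: "f \<in> ?S" "f \<in> hom C Y X"
      then obtain i g where i: "i \<in> I" and g: "g \<in> hom C Y (T i)" and fg: "f = \<iota> i \<cdot> g"
        using mem by (auto simp: hom_def)
      show "s f \<in> Sections F Y" using s_eq[OF i g] Restrict_in[OF g tI[OF i]] fg by simp
      fix k V assume k: "k \<in> hom C V Y"
      show "s (f \<cdot> k) = Restrict F k (s f)"
        using s_eq[OF i g] s_eq[OF i Comp_hom[OF k g]] Restrict_Comp[OF k g tI[OF i]]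
          Comp_assoc[OF k g \<iota>[OF i]] fg by simp
    qed
    then obtain x where x: "x \<in> Sections F X" and xs: "\<And>f. f \<in> ?S \<Longrightarrow> Restrict F f x = s f"
      using sh unfolding sheaf_for_def by blast
    have "Restrict F (\<iota> i) x = t i" if i: "i \<in> I" for i
    proof -
      have TO: "T i \<in> Obj C" using hom_Obj[OF \<iota>[OF i]] by blast
      show ?thesis
        using xs[OF gen[OF i]] i s_eq[OF i Id_hom[OF TO]] Comp_Id[OF \<iota>[OF i]] Restrict_Id[OF TO tI[OF i]] by simp
    qed
    then have "?r x = t" using t by (auto simp: PiE_def extensional_def restrict_def fun_eq_iff)
    then show "t \<in> ?r ` Sections F X" using x by blast
  qed
  ultimately show ?thesis unfolding bij_betw_def by blast
qed

end

section \<open>Sheaves for the extensive topology\<close>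

lemma coproduct_sieve_covers:
  fixes I :: "nat set"
  assumes "finite I" "is_coproduct C I T X \<iota>"
  shows "generated_sieve C (\<iota> ` I) \<in> extensive_topology C X"
  using assms extensive_topology_covers[of C] unfolding covers_finite_coproducts_def by simp

locale extensive_presheaf = finitary_extensive C + presheaf C F
  for C :: "('o, 'a) category" (structure) and F :: "('o, 'a, 'x) presheaf"
begin

text \<open>Compatibility of an arbitrary tuple of sections comes from monic, disjoint
  coprojections and from \<open>F(0)\<close> having at most one element.\<close>
lemma sheaf_preserves_finite_products:
  assumes sheaf: "is_sheaf C (extensive_topology C) F"
  shows "preserves_finite_products C F"
proof -
  have sh: "sheaf_for C F X (generated_sieve C (\<iota> ` I))"
    if "finite I" "is_coproduct C I T X \<iota>" for I :: "nat set" and T X \<iota>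
    using sheaf coproduct_sieve_covers[OF that] that(2)
    unfolding is_sheaf_iff is_coproduct_def by blast
  obtain Z where Z: "is_initial C Z" by (rule obtain_initial)
  have Zsub: "x = y" if "x \<in> Sections F Z" "y \<in> Sections F Z" for x y
  proof -
    have cop: "is_coproduct C ({} :: nat set) (\<lambda>_. Z) Z (\<lambda>_. Id C Z)"
      using Z by (simp add: is_coproduct_empty_iff)
    show ?thesis
      by (rule sheaf_forD_separated[OF sh[OF finite.emptyI cop] coproduct_sieve[OF cop] that])
        (simp add: generated_sieve_def)
  qed
  show ?thesis
    unfolding preserves_finite_products_def
  proof (intro allI impI)
    fix I :: "nat set" and T X \<iota> assume "finite I \<and> is_coproduct C I T X \<iota>"
    then have I: "finite I" and X: "is_coproduct C I T X \<iota>" by auto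
    show "bij_betw (\<lambda>x. \<lambda>i\<in>I. Restrict F (\<iota> i) x) (Sections F X) (\<Pi>\<^sub>E i\<in>I. Sections F (T i))"
    proof (rule coproduct_sections_bij[OF X sh[OF I X]])
      fix t i j V u v
      assume t: "\<And>i. i \<in> I \<Longrightarrow> t i \<in> Sections F (T i)" and i: "i \<in> I" and j: "j \<in> I"
        and u: "u \<in> hom C V (T i)" and v: "v \<in> hom C V (T j)" and eq: "\<iota> i \<cdot> u = \<iota> j \<cdot> v"
      show "Restrict F u (t i) = Restrict F v (t j)"
      proof (cases "i = j")
        case True
        then show ?thesis using coprojection_mono[OF I i X u] v eq by simp
      next
        case False
        have "T i \<in> Obj C" "T j \<in> Obj C" using X i j by (simp_all add: is_coproduct_def)
        then obtain e d where e: "e \<in> hom C Z (T i)" and d: "d \<in> hom C Z (T j)"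
          using Z unfolding is_initial_def by blast
        obtain h where h: "h \<in> hom C V Z" "e \<cdot> h = u" "d \<cdot> h = v"
          by (rule coprojections_disjoint[OF I i j False X u v eq Z e d])
        have "Restrict F e (t i) = Restrict F d (t j)"
          using Zsub Restrict_in e d t i j by blast
        then show ?thesis
          using Restrict_Comp[OF h(1) e t[OF i]] Restrict_Comp[OF h(1) d t[OF j]] h by simp
      qed
    qed
  qed
qed

text \<open>By minimality, the extensive topology is contained in any topology in which finite
  coproducts cover, and \<open>sheaf_topology C F\<close> is shown to be one.\<close>
lemma preserves_finite_products_is_sheaf:
  assumes pres: "preserves_finite_products C F"
  shows "is_sheaf C (extensive_topology C) F"
proof -
  have sh: "sheaf_for C F X (generated_sieve C (\<iota> ` I))"
    if "finite I" "is_coproduct C I T X \<iota>" for I :: "nat set" and T X \<iota>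
  proof (rule sheaf_for_coproduct_sieve[OF that(2)])
    show "bij_betw (\<lambda>x. \<lambda>i\<in>I. Restrict F (\<iota> i) x) (Sections F X) (\<Pi>\<^sub>E i\<in>I. Sections F (T i))"
      using pres that unfolding preserves_finite_products_def by blast
  qed
  have "covers_finite_coproducts C (sheaf_topology C F)"
  proof (rule covers_finite_coproductsI[OF sheaf_topology_topology])
    fix Z assume Z: "is_initial C Z"
    have "sheaf_for C F Y (pullback_sieve C f {})" if f: "f \<in> hom C Y Z" for Y f
    proof -
      have "is_coproduct C ({} :: nat set) (\<lambda>_. Y) Y (\<lambda>_. f)"
        using initial_strict[OF Z f] by (simp add: is_coproduct_empty_iff)
      from sh[OF finite.emptyI this] show ?thesis by (simp add: generated_sieve_def pullback_sieve_def)
    qed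
    then show "{} \<in> sheaf_topology C F Z"
      using Z by (simp add: sheaf_topology_def is_sieve_def is_initial_def)
  next
    fix X Y P \<iota>\<^sub>1 \<iota>\<^sub>2 assume P: "is_binary_coproduct C X Y P \<iota>\<^sub>1 \<iota>\<^sub>2"
    have img: "(case_bool c d \<circ> (\<lambda>n. n = 0)) ` {0, 1 :: nat} = {c, d}" for c d :: 'a by simp
    note N = binary_coproduct_nat_indexed[OF P]
    have \<iota>: "case_bool \<iota>\<^sub>1 \<iota>\<^sub>2 c \<in> hom C (case_bool X Y c) P" for c
      using P by (cases c) (auto simp: is_binary_coproduct_iff)
    have "sheaf_for C F Z (pullback_sieve C f (generated_sieve C {\<iota>\<^sub>1, \<iota>\<^sub>2}))"
      if f: "f \<in> hom C Z P" for Z f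
    proof -
      obtain Z\<^sub>1 Z\<^sub>2 a z\<^sub>1 b z\<^sub>2 where pb: "is_pullback C a z\<^sub>1 \<iota>\<^sub>1 f" "is_pullback C b z\<^sub>2 \<iota>\<^sub>2 f"
        and Z: "is_binary_coproduct C Z\<^sub>1 Z\<^sub>2 Z z\<^sub>1 z\<^sub>2"
        by (rule binary_coproduct_universal[OF P f])
      have "pullback_sieve C f (generated_sieve C (case_bool \<iota>\<^sub>1 \<iota>\<^sub>2 ` UNIV)) =
          generated_sieve C (case_bool z\<^sub>1 z\<^sub>2 ` UNIV)"
      proof (rule pullback_generated_sieve[OF _ f, where T = "case_bool X Y" and p = "case_bool a b"])
        fix c
        show "is_pullback C (case_bool a b c) (case_bool z\<^sub>1 z\<^sub>2 c) (case_bool \<iota>\<^sub>1 \<iota>\<^sub>2 c) f"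
          using pb by (cases c) auto
      qed (rule \<iota>)
      then have "pullback_sieve C f (generated_sieve C {\<iota>\<^sub>1, \<iota>\<^sub>2}) = generated_sieve C {z\<^sub>1, z\<^sub>2}"
        by (simp add: UNIV_bool insert_commute)
      then show ?thesis
        using sh[OF _ binary_coproduct_nat_indexed[OF Z]] unfolding img by simp
    qed
    moreover have "is_sieve C P (generated_sieve C {\<iota>\<^sub>1, \<iota>\<^sub>2})"
      using coproduct_sieve[OF N] unfolding img .
    ultimately show "generated_sieve C {\<iota>\<^sub>1, \<iota>\<^sub>2} \<in> sheaf_topology C F P"
      by (simp add: sheaf_topology_def)
  qed
  then have sub: "\<And>X. extensive_topology C X \<subseteq> sheaf_topology C F X"
    using extensive_topology_least[OF sheaf_topology_topology] by blast
  \<comment> \<open>the sieve itself is its pullback along the identity\<close>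
  have "sheaf_for C F X S" if X: "X \<in> Obj C" and "S \<in> extensive_topology C X" for X S
  proof -
    have S: "S \<in> sheaf_topology C F X" using that sub by blast
    then have "sheaf_for C F X (pullback_sieve C (Id C X) S)"
      using Id_hom[OF X] by (simp add: sheaf_topology_def)
    then show ?thesis using pullback_sieve_Id[of X S] S by (simp add: sheaf_topology_def)
  qed
  then show ?thesis unfolding is_sheaf_iff by blast
qed

end

theorem proposition6p5:
  fixes C :: "('o, 'a) category" and F :: "('o, 'a, 'x) presheaf"
  assumes "finitary_extensive C" and "presheaf C F"
  shows "is_sheaf C (extensive_topology C) F \<longleftrightarrow> preserves_finite_products C F"
proof -
  interpret extensive_presheaf C F
    using assms by (rule extensive_presheaf.intro)
  show ?thesis
    using sheaf_preserves_finite_products preserves_finite_products_is_sheaf by blast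
qed

end
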